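(* Let $\Omega\subset\mathbb{C}$ be a simply connected domain, let $f=h\overline{g}$ be a sense-preserving locally univalent logharmonic mapping defined in $\Omega$ with dilatation $\omega$, and let $\varphi$ be a locally univalent holomorphic mapping in $\Omega$. Then $P_f=P\varphi$ in $\Omega$ if and only if there exist complex constants $c$, $d$ and $k$ with $\operatorname{Re}\{k\}>1/2$ such that, on $\Omega$, $$h=(c\varphi+d)^k\quad\text{and}\quad \omega=\frac{1-k}{k}.$$
   Context: A sense-preserving locally univalent logharmonic mapping $f=h\overline{g}$ on a domain: $h,g$ are analytic there, $h'$ does not vanish, $g$ does not vanish, and the (second complex) dilatation $\omega=\dfrac{g'h}{gh'}$ satisfies $|\omega|<1$ everywhere. Its pre-Schwarzian derivative is $$P_f=\frac{h''}{h'}+\omega\frac{h'}{h}-\frac{\omega'\overline{\omega}}{1-|\omega|^2},$$ where $\omega\, h'/h=g'/g$ (and the term is understood as $g'/g$ at a zero of $h$). For a locally univalent holomorphic function $\varphi$ (i.e. $\varphi'\neq0$ everywhere), $P\varphi=\varphi''/\varphi'$. The power $(c\varphi+d)^k$ is understood as a holomorphic branch on $\Omega$: if $k=1$ it is $c\varphi+d$ itself; if $k\neq1$, then $c\varphi+d$ is non-vanishing on $\Omega$ and $(c\varphi+d)^k=e^{k\ell}$ for some holomorphic $\ell$ on $\Omega$ with $e^{\ell}=c\varphi+d$. *)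

theory Defs
  imports "HOL-Complex_Analysis.Complex_Analysis"
begin

definition loc_univalent_holomorphic :: "complex set \<Rightarrow> (complex \<Rightarrow> complex) \<Rightarrow> bool" where
  "loc_univalent_holomorphic S \<phi> \<longleftrightarrow>
     \<phi> holomorphic_on S \<and> (\<forall>z\<in>S. deriv \<phi> z \<noteq> 0)"

definition pre_schwarzian :: "(complex \<Rightarrow> complex) \<Rightarrow> complex \<Rightarrow> complex" where
  "pre_schwarzian \<phi> z = deriv (deriv \<phi>) z / deriv \<phi> z"

definition dilatation :: "(complex \<Rightarrow> complex) \<Rightarrow> (complex \<Rightarrow> complex) \<Rightarrow> complex \<Rightarrow> complex" where
  "dilatation h g z = deriv g z * h z / (g z * deriv h z)"

(* h may vanish on S. *)
definition sp_loc_univalent_logharmonic ::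
  "complex set \<Rightarrow> (complex \<Rightarrow> complex) \<Rightarrow> (complex \<Rightarrow> complex) \<Rightarrow> (complex \<Rightarrow> complex) \<Rightarrow> bool" where
  "sp_loc_univalent_logharmonic S f h g \<longleftrightarrow>
     h holomorphic_on S \<and> g holomorphic_on S \<and>
     (\<forall>z\<in>S. f z = h z * cnj (g z)) \<and>
     (\<forall>z\<in>S. deriv h z \<noteq> 0) \<and> (\<forall>z\<in>S. g z \<noteq> 0) \<and>
     (\<forall>z\<in>S. cmod (dilatation h g z) < 1)"

(* The pre-Schwarzian of f = h * cnj g.  Since \<omega> h'/h = g'/g where h \<noteq> 0, the value g'/g
   is the continuous extension of the middle term to the zeros of h. *)
definition pre_schwarzian_logharmonic ::
  "(complex \<Rightarrow> complex) \<Rightarrow> (complex \<Rightarrow> complex) \<Rightarrow> complex \<Rightarrow> complex" where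
  "pre_schwarzian_logharmonic h g z =
     (let \<omega> = dilatation h g in
        deriv (deriv h) z / deriv h z
        + (if h z = 0 then deriv g z / g z else \<omega> z * (deriv h z / h z))
        - deriv \<omega> z * cnj (\<omega> z) / (1 - (complex_of_real (cmod (\<omega> z)))\<^sup>2))"

(* p is a holomorphic branch of u^k on S.  For k = 1 the base u may have zeros; the principal
   branch powr is not used, as it need not be holomorphic on S. *)
definition is_power_branch ::
  "complex set \<Rightarrow> (complex \<Rightarrow> complex) \<Rightarrow> complex \<Rightarrow> (complex \<Rightarrow> complex) \<Rightarrow> bool" where
  "is_power_branch S u k p \<longleftrightarrow>
     (if k = 1 then \<forall>z\<in>S. p z = u z
      else (\<forall>z\<in>S. u z \<noteq> 0) \<and>
           (\<exists>l. l holomorphic_on S \<and> (\<forall>z\<in>S. exp (l z) = u z) \<and> (\<forall>z\<in>S. p z = exp (k * l z))))"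

end

theory Submission
  imports Defs
begin

text \<open>If \<open>P\<^sub>f = P\<phi>\<close>, then \<open>\<omega>' cnj \<omega> / (1 - \<bar>\<omega>\<bar>\<^sup>2)\<close> is holomorphic, which forces \<open>\<omega>\<close> to be
  a constant \<open>a\<close>. What remains, \<open>h'' / h' + g' / g = \<phi>'' / \<phi>'\<close>, integrates to \<open>h' g = C \<phi>'\<close>.
  For \<open>a = 0\<close> the function \<open>g\<close> is constant. Otherwise \<open>h\<close> has no zeros, so \<open>h = exp L\<close>,
  \<open>g = B exp (a L)\<close>, and a second integration shows that \<open>exp ((1 + a) L)\<close> is affine in \<open>\<phi>\<close>.
  Hence \<open>k = 1 / (1 + a)\<close>, and this map takes the unit disc to the half-plane \<open>Re k > 1/2\<close>.\<close>

section \<open>Rigidity of holomorphic functions\<close>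

lemma constant_on_real_image:
  assumes "f holomorphic_on S" "open S" "connected S" "f ` S \<subseteq> \<real>"
  shows "f constant_on S"
proof (rule ccontr)
  assume nc: "\<not> f constant_on S"
  then obtain z where z: "z \<in> S"
    by (auto simp: constant_on_def)
  have "open (f ` S)"
    using open_mapping_thm[of f S S] assms nc by auto
  then obtain e where e: "e > 0" "ball (f z) e \<subseteq> f ` S"
    using z by (auto simp: open_contains_ball)
  \<comment> \<open>The image of a nonconstant \<open>f\<close> would be open. It would then contain
    a vertical displacement of the real number \<open>f z\<close>, which is not real.\<close>
  have "f z + \<i> * complex_of_real (e / 2) \<in> ball (f z) e"
    using e by (simp add: dist_norm norm_mult)
  hence "f z + \<i> * complex_of_real (e / 2) \<in> \<real>"
    using e assms by blast
  moreover have "f z \<in> \<real>"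
    using z assms by blast
  ultimately show False
    using e by (simp add: complex_is_Real_iff)
qed

text \<open>A constant modulus attains its maximum at every point, so the maximum modulus principle
  applies with any point of \<open>S\<close> as maximiser.\<close>

lemma constant_on_if_norm_constant_on:
  fixes f :: "complex \<Rightarrow> complex"
  assumes "f holomorphic_on S" "open S" "connected S"
    and "\<And>z w. z \<in> S \<Longrightarrow> w \<in> S \<Longrightarrow> norm (f z) = norm (f w)"
  shows "f constant_on S"
proof (cases "S = {}")
  case True
  then show ?thesis by (simp add: constant_on_def)
next
  case False
  then obtain \<xi> where "\<xi> \<in> S" by blast
  then show ?thesis
    by (intro maximum_modulus_principle[OF assms(1-3,2) order_refl] eq_refl assms(4))
qed

text \<open>Where \<open>\<omega>' \<noteq> 0\<close>, dividing by \<open>\<omega>'\<close> makes \<open>cnj \<omega> / (1 - \<bar>\<omega>\<bar>\<^sup>2)\<close> holomorphic,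
  and its product with \<open>\<omega>\<close> is real valued.\<close>

lemma constant_on_if_holomorphic_dilatation_term:
  assumes w: "\<omega> holomorphic_on S" "open S" "connected S"
    and lt: "\<And>z. z \<in> S \<Longrightarrow> cmod (\<omega> z) < 1"
    and F: "(\<lambda>z. deriv \<omega> z * cnj (\<omega> z) / (1 - (complex_of_real (cmod (\<omega> z)))\<^sup>2)) holomorphic_on S"
      (is "?F holomorphic_on S")
  shows "\<omega> constant_on S"
proof -
  have "deriv \<omega> z = 0" if z: "z \<in> S" for z
  proof (rule ccontr)
    assume nz: "deriv \<omega> z \<noteq> 0"
    have hd: "deriv \<omega> holomorphic_on S"
      by (simp add: holomorphic_deriv w)
    hence "open (deriv \<omega> -` (-{0}) \<inter> S)"
      using continuous_on_open_vimage[OF w(2), of "deriv \<omega>"] holomorphic_on_imp_continuous_on by blast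
    moreover have "z \<in> deriv \<omega> -` (-{0}) \<inter> S"
      using z nz by simp
    ultimately obtain r where r: "r > 0" "ball z r \<subseteq> deriv \<omega> -` (-{0}) \<inter> S"
      by (rule openE)
    \<comment> \<open>Constancy arguments need a connected domain, hence a disc rather than the
      whole set where \<omega>' is nonzero.\<close>
    define B where "B = ball z r"
    have B: "open B" "connected B" "z \<in> B" "B \<subseteq> S" "\<And>x. x \<in> B \<Longrightarrow> deriv \<omega> x \<noteq> 0"
      using r by (auto simp: B_def)
    define H where "H x = ?F x / deriv \<omega> x * \<omega> x" for x
    define R where "R x = (cmod (\<omega> x))\<^sup>2 / (1 - (cmod (\<omega> x))\<^sup>2)" for x
    have HR: "H x = of_real (R x)" if "x \<in> B" for x
      using B(5)[OF that] complex_norm_square[of "\<omega> x"]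
      by (simp add: H_def R_def mult.commute)
    have "H holomorphic_on B"
      unfolding H_def
      by (rule holomorphic_on_mult[OF holomorphic_on_divide[OF holomorphic_on_subset[OF F B(4)]
            holomorphic_on_subset[OF hd B(4)] B(5)] holomorphic_on_subset[OF w(1) B(4)]])
    hence "H constant_on B"
      using B HR by (intro constant_on_real_image) auto
    then obtain c where c: "\<And>x. x \<in> B \<Longrightarrow> H x = c"
      by (auto simp: constant_on_def)
    \<comment> \<open>\<open>R\<close> is t / (1 - t) at t = |\<omega>|^2. Solving for t shows that
      a constant \<open>R\<close> gives a constant modulus.\<close>
    have sq: "(cmod (\<omega> x))\<^sup>2 = R x / (1 + R x)" if "x \<in> B" for x
    proof -
      have "(cmod (\<omega> x))\<^sup>2 < 1"
        using lt[of x] that B by (simp add: abs_square_less_1 subset_iff)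
      thus ?thesis by (simp add: R_def field_simps)
    qed
    have "norm (\<omega> x) = norm (\<omega> y)" if "x \<in> B" "y \<in> B" for x y
    proof -
      have "R x = R y"
        using HR c that by (metis of_real_eq_iff)
      hence "(cmod (\<omega> x))\<^sup>2 = (cmod (\<omega> y))\<^sup>2"
        using sq that by simp
      thus ?thesis by simp
    qed
    hence "\<omega> constant_on B"
      by (rule constant_on_if_norm_constant_on[OF holomorphic_on_subset[OF w(1) B(4)] B(1,2)])
    thus False
      using holomorphic_nonconstant[OF holomorphic_on_subset[OF w(1) B(4)] B(1,3) nz] by simp
  qed
  hence "(\<omega> has_field_derivative 0) (at z)" if "z \<in> S" for z
    using holomorphic_derivI[OF w(1,2) that, of UNIV] that by simp
  thus ?thesis
    by (rule has_field_derivative_0_imp_constant_on[OF _ w(3,2)])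
qed

section \<open>Integration lemmas, and the range of the exponent\<close>

lemma proportional_if_logderiv_eq:
  fixes u v :: "complex \<Rightarrow> complex"
  assumes S: "open S" "connected S" "S \<noteq> {}"
    and uv: "u holomorphic_on S" "v holomorphic_on S"
    and nz: "\<And>z. z \<in> S \<Longrightarrow> u z \<noteq> 0" "\<And>z. z \<in> S \<Longrightarrow> v z \<noteq> 0"
    and eq: "\<And>z. z \<in> S \<Longrightarrow> deriv u z / u z = deriv v z / v z"
  obtains c where "c \<noteq> 0" "\<And>z. z \<in> S \<Longrightarrow> u z = c * v z"
proof -
  \<comment> \<open>Cross-multiplying \<open>eq\<close> gives u' v = u v', so the numerator in the
    quotient rule vanishes.\<close>
  have "((\<lambda>z. u z / v z) has_field_derivative 0) (at z)" if "z \<in> S" for z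
    by (rule DERIV_cong[OF DERIV_divide[OF holomorphic_derivI[OF uv(1) S(1) that]
          holomorphic_derivI[OF uv(2) S(1) that] nz(2)[OF that]]])
       (use nz that eq[OF that] in \<open>simp add: frac_eq_eq\<close>)
  hence "(\<lambda>z. u z / v z) constant_on S"
    using S by (intro has_field_derivative_0_imp_constant_on)
  then obtain c where c: "\<And>z. z \<in> S \<Longrightarrow> u z / v z = c"
    by (auto simp: constant_on_def)
  show thesis
  proof (rule that[of c])
    show "c \<noteq> 0" using c nz S(3) by fastforce
    show "u z = c * v z" if "z \<in> S" for z
      using c[OF that] nz that by (auto simp: field_simps)
  qed
qed

lemma antiderivative_unique:
  fixes u v :: "complex \<Rightarrow> complex"
  assumes S: "open S" "connected S"
    and "u holomorphic_on S" "v holomorphic_on S"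
    and eq: "\<And>z. z \<in> S \<Longrightarrow> deriv u z = deriv v z"
  obtains d where "\<And>z. z \<in> S \<Longrightarrow> u z = v z + d"
proof -
  have "((\<lambda>z. u z - v z) has_field_derivative 0) (at z)" if "z \<in> S" for z
    by (rule DERIV_cong[OF DERIV_diff[OF holomorphic_derivI[OF assms(3) S(1) that]
          holomorphic_derivI[OF assms(4) S(1) that]]]) (simp add: eq that)
  hence "(\<lambda>z. u z - v z) constant_on S"
    using S by (intro has_field_derivative_0_imp_constant_on)
  then obtain d where "\<And>z. z \<in> S \<Longrightarrow> u z - v z = d"
    by (auto simp: constant_on_def)
  thus thesis by (intro that[of d]) (auto simp: algebra_simps)
qed

text \<open>Serves the case of zero dilatation. At a zero of \<open>h\<close> the dilatation
  vanishes whatever g' is, so g' = 0 needs a separate argument there.\<close>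

lemma deriv_eq_0_if_deriv_mult_eq_0:
  assumes S: "open S" "g holomorphic_on S" "h holomorphic_on S"
    and nz: "\<And>z. z \<in> S \<Longrightarrow> deriv h z \<noteq> 0"
    and eq: "\<And>z. z \<in> S \<Longrightarrow> deriv g z * h z = 0"
    and z: "z \<in> S"
  shows "deriv g z = 0"
proof (cases "h z = 0")
  case True
  \<comment> \<open>Differentiating \<open>g' h = 0\<close> at a zero of \<open>h\<close> leaves \<open>g' h' = 0\<close>.\<close>
  have dg: "deriv g holomorphic_on S"
    by (simp add: holomorphic_deriv S)
  have "((\<lambda>x. deriv g x * h x) has_field_derivative
      deriv (deriv g) z * h z + deriv h z * deriv g z) (at z)"
    by (rule DERIV_mult holomorphic_derivI[OF dg S(1) z] holomorphic_derivI[OF S(3,1) z])+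
  moreover have "((\<lambda>x. deriv g x * h x) has_field_derivative 0) (at z)"
    by (rule has_field_derivative_transform_within_open[OF DERIV_const[of 0] S(1) z])
       (use eq in auto)
  ultimately have "deriv (deriv g) z * h z + deriv h z * deriv g z = 0"
    by (rule DERIV_unique)
  thus ?thesis using True nz z by auto
qed (use eq z in auto)

text \<open>The real part is (1 + Re a) / |1 + a|^2. It exceeds 1/2 exactly when 2 + 2 Re a > 1 + 2
  Re a + |a|^2, that is, when |a| < 1.\<close>

lemma inverse_one_plus_half_plane:
  assumes "cmod a < 1"
  shows "1 + a \<noteq> 0" "Re (1 / (1 + a)) > 1 / 2"
proof -
  show *: "1 + a \<noteq> 0"
    using assms by (metis add.commute add_eq_0_iff norm_minus_cancel norm_one less_irrefl)
  have "(Re a)\<^sup>2 + (Im a)\<^sup>2 < 1"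
    using assms abs_square_less_1[of "cmod a"] by (simp add: cmod_power2)
  moreover have "(1 + Re a)\<^sup>2 + (Im a)\<^sup>2 > 0"
    using * by (auto simp: complex_eq_iff sum_power2_gt_zero_iff)
  ultimately show "Re (1 / (1 + a)) > 1 / 2"
    by (simp add: Re_divide field_simps power2_eq_square)
qed

section \<open>The pre-Schwarzian of a logharmonic mapping\<close>

locale logharmonic_setup =
  fixes S :: "complex set" and f h g \<phi> :: "complex \<Rightarrow> complex"
  assumes S: "open S" "connected S" "S \<noteq> {}"
    and fhg: "sp_loc_univalent_logharmonic S f h g"
    and lu: "loc_univalent_holomorphic S \<phi>"
begin

lemma hol: "h holomorphic_on S" "g holomorphic_on S" "\<phi> holomorphic_on S"
  and hol': "deriv h holomorphic_on S" "deriv g holomorphic_on S" "deriv \<phi> holomorphic_on S"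
  using fhg lu S
  by (auto simp: sp_loc_univalent_logharmonic_def loc_univalent_holomorphic_def
      intro: holomorphic_deriv)

lemma nz: "z \<in> S \<Longrightarrow> deriv h z \<noteq> 0" "z \<in> S \<Longrightarrow> g z \<noteq> 0" "z \<in> S \<Longrightarrow> deriv \<phi> z \<noteq> 0"
  and dilatation_less_1: "z \<in> S \<Longrightarrow> cmod (dilatation h g z) < 1"
  using fhg lu by (auto simp: sp_loc_univalent_logharmonic_def loc_univalent_holomorphic_def)

lemma holomorphic_dilatation: "dilatation h g holomorphic_on S"
proof -
  have "(\<lambda>z. deriv g z * h z / (g z * deriv h z)) holomorphic_on S"
    using hol hol' nz S by (intro holomorphic_intros) auto
  thus ?thesis by (simp add: dilatation_def[abs_def])
qed

text \<open>Removes the conjugate term from the pre-Schwarzian once \<omega> is constant.\<close>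

lemma deriv_dilatation_eq_0_if_constant_on:
  assumes "dilatation h g constant_on S" "z \<in> S"
  shows "deriv (dilatation h g) z = 0"
  using holomorphic_nonconstant[OF holomorphic_dilatation S(1) assms(2)] assms(1) by blast

text \<open>Where \<open>h\<close> is nonzero, \<omega> h' / h simplifies to g' / g, so both cases
  of the definition agree and the zeros of \<open>h\<close> need no further attention.\<close>

lemma pre_schwarzian_logharmonic_eq:
  assumes "z \<in> S"
  shows "pre_schwarzian_logharmonic h g z = deriv (deriv h) z / deriv h z + deriv g z / g z
    - deriv (dilatation h g) z * cnj (dilatation h g z)
        / (1 - (complex_of_real (cmod (dilatation h g z)))\<^sup>2)"
  proof -
  have "dilatation h g z * (deriv h z / h z) = deriv g z / g z" if "h z \<noteq> 0"
    using nz[OF assms] that by (simp add: dilatation_def)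
  thus ?thesis
    by (simp add: pre_schwarzian_logharmonic_def Let_def)
qed

lemma dilatation_constant_on:
  assumes "\<And>z. z \<in> S \<Longrightarrow> pre_schwarzian_logharmonic h g z = pre_schwarzian \<phi> z"
  shows "dilatation h g constant_on S"
proof (rule constant_on_if_holomorphic_dilatation_term[OF holomorphic_dilatation S(1,2) dilatation_less_1])
  \<comment> \<open>Solving P_f = P\<phi> for the conjugate term expresses it by quotients whose
    denominators h', g and \<phi>' have no zeros.\<close>
  have "(\<lambda>z. deriv (deriv h) z / deriv h z + deriv g z / g z - deriv (deriv \<phi>) z / deriv \<phi> z)
      holomorphic_on S"
    using hol hol' nz S by (intro holomorphic_intros) auto
  thus "(\<lambda>z. deriv (dilatation h g) z * cnj (dilatation h g z)
      / (1 - (complex_of_real (cmod (dilatation h g z)))\<^sup>2)) holomorphic_on S"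
    by (rule holomorphic_transform)
       (use assms in \<open>auto simp: pre_schwarzian_logharmonic_eq pre_schwarzian_def algebra_simps\<close>)
qed

section \<open>From equal pre-Schwarzians to a power of an affine function of \<phi>\<close>

lemma power_branch_if_deriv_mult_proportional:
  assumes sc: "simply_connected S"
    and a: "\<And>z. z \<in> S \<Longrightarrow> dilatation h g z = a"
    and C: "\<And>z. z \<in> S \<Longrightarrow> deriv h z * g z = C * deriv \<phi> z"
  shows "\<exists>c d. is_power_branch S (\<lambda>z. c * \<phi> z + d) (1 / (1 + a)) h"
proof -
  have a1: "1 + a \<noteq> 0"
  proof -
    obtain z where "z \<in> S" using S(3) by blast
    thus ?thesis
      using a dilatation_less_1 inverse_one_plus_half_plane(1)[of a] by metis
  qed
  \<comment> \<open>This is g' / g = a h' / h cleared of denominators, so that it also holds at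
    zeros of \<open>h\<close>.\<close>
  have gh: "deriv g z * h z = a * g z * deriv h z" if "z \<in> S" for z
    using a[OF that] nz that by (auto simp: dilatation_def field_simps)
  show ?thesis
  \<comment> \<open>For a = 0 the exponent is 1 and \<open>h\<close> may vanish, so no logarithm of
    \<open>h\<close> is available. This matches the separate clause for k = 1 in
    \<open>is_power_branch\<close>.\<close>
  proof (cases "a = 0")
    case True
    have "deriv g z = 0" if "z \<in> S" for z
      by (rule deriv_eq_0_if_deriv_mult_eq_0[OF S(1) hol(2,1)]) (use nz gh True that in auto)
    hence "(g has_field_derivative 0) (at z)" if "z \<in> S" for z
      using holomorphic_derivI[OF hol(2) S(1) that, of UNIV] that by simp
    hence "g constant_on S"
      by (rule has_field_derivative_0_imp_constant_on[OF _ S(2,1)])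
    then obtain b where b: "\<And>z. z \<in> S \<Longrightarrow> g z = b"
      by (auto simp: constant_on_def)
    have "b \<noteq> 0" using b S(3) nz(2) by blast
    obtain d where "\<And>z. z \<in> S \<Longrightarrow> h z = C / b * \<phi> z + d"
    proof (rule antiderivative_unique[OF S(1,2) hol(1), of "\<lambda>z. C / b * \<phi> z"])
      show "(\<lambda>z. C / b * \<phi> z) holomorphic_on S"
        by (intro holomorphic_intros hol)
      show "deriv h z = deriv (\<lambda>z. C / b * \<phi> z) z" if "z \<in> S" for z
        using C[OF that] b[OF that] \<open>b \<noteq> 0\<close>
        by (subst deriv_cmult[OF holomorphic_on_imp_differentiable_at[OF hol(3) S(1) that]])
          (simp add: field_simps)
    qed auto
    hence "is_power_branch S (\<lambda>z. C / b * \<phi> z + d) (1 / (1 + a)) h"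
      using True by (simp add: is_power_branch_def)
    thus ?thesis by blast
  next
    case False
    \<comment> \<open>At a zero of \<open>h\<close> the left side of \<open>gh\<close> would vanish,
      while a, g and h' are nonzero.\<close>
    have h0: "h z \<noteq> 0" if "z \<in> S" for z
      using gh[OF that] nz that False by auto
    \<comment> \<open>Simple connectivity enters here: the zero-free \<open>h\<close> has a
      holomorphic logarithm.\<close>
    obtain L where L: "L holomorphic_on S" "\<And>z. z \<in> S \<Longrightarrow> h z = exp (L z)"
      using sc hol(1) h0 unfolding simply_connected_eq_holomorphic_log[OF S(1)] by blast
    note dL = holomorphic_derivI[OF L(1) S(1)]
    have dh: "deriv h z = deriv L z * exp (L z)" if "z \<in> S" for z
    proof (rule DERIV_imp_deriv)
      have "((\<lambda>z. exp (L z)) has_field_derivative deriv L z * exp (L z)) (at z)"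
        by (rule derivative_eq_intros dL[OF that] refl)+ simp
      thus "(h has_field_derivative deriv L z * exp (L z)) (at z)"
        by (rule has_field_derivative_transform_within_open[OF _ S(1) that]) (use L in auto)
    qed
    have dE: "deriv (\<lambda>z. exp (b * L z)) z = b * deriv L z * exp (b * L z)" if "z \<in> S" for z b
      by (rule DERIV_imp_deriv, (rule derivative_eq_intros dL[OF that] refl)+) simp
    obtain B where B: "B \<noteq> 0" "\<And>z. z \<in> S \<Longrightarrow> g z = B * exp (a * L z)"
    proof (rule proportional_if_logderiv_eq[OF S hol(2), of "\<lambda>z. exp (a * L z)"])
      show "(\<lambda>z. exp (a * L z)) holomorphic_on S"
        by (intro holomorphic_intros L)
      show "deriv g z / g z = deriv (\<lambda>z. exp (a * L z)) z / exp (a * L z)" if "z \<in> S" for z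
        using gh[OF that] dh[OF that] dE[OF that] L(2)[OF that] nz(2)[OF that]
        by (simp add: field_simps)
    qed (use nz in auto)
    \<comment> \<open>Substituting h = exp L and g = B exp (a L) in h' g = C \<phi>' gives B L' exp
      ((1 + a) L) = C \<phi>'. Hence exp ((1 + a) L) has derivative (1 + a) (C / B) \<phi>'.\<close>
    define c where "c = (1 + a) * C / B"
    obtain d where d: "\<And>z. z \<in> S \<Longrightarrow> exp ((1 + a) * L z) = c * \<phi> z + d"
    proof (rule antiderivative_unique[OF S(1,2), of "\<lambda>z. exp ((1 + a) * L z)" "\<lambda>z. c * \<phi> z"])
      show "(\<lambda>z. exp ((1 + a) * L z)) holomorphic_on S" "(\<lambda>z. c * \<phi> z) holomorphic_on S"
        by (intro holomorphic_intros hol L)+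
      show "deriv (\<lambda>z. exp ((1 + a) * L z)) z = deriv (\<lambda>z. c * \<phi> z) z" if "z \<in> S" for z
      proof -
        have "B * (deriv L z * exp ((1 + a) * L z)) = C * deriv \<phi> z"
          using C[OF that] dh[OF that] B(2)[OF that] by (simp add: ring_distribs exp_add mult_ac)
        hence "deriv L z * exp ((1 + a) * L z) = C / B * deriv \<phi> z"
          using B(1) by (simp add: field_simps)
        thus ?thesis
          by (subst deriv_cmult[OF holomorphic_on_imp_differentiable_at[OF hol(3) S(1) that]])
             (simp add: dE[OF that] c_def mult.assoc)
      qed
    qed auto
    have "is_power_branch S (\<lambda>z. c * \<phi> z + d) (1 / (1 + a)) h"
      unfolding is_power_branch_def
    proof (subst if_not_P, use False a1 in force, intro conjI ballI exI)
      \<comment> \<open>The required logarithm of c \<phi> + d is (1 + a) L. Multiplying it by k = 1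
        / (1 + a) returns L, the logarithm of \<open>h\<close>.\<close>
      show "(\<lambda>z. (1 + a) * L z) holomorphic_on S"
        by (intro holomorphic_intros L)
      show "c * \<phi> z + d \<noteq> 0" if "z \<in> S" for z
        using d[OF that] exp_not_eq_zero by metis
    qed (use d L a1 in auto)
    thus ?thesis by blast
  qed
qed

text \<open>Once \<omega> is a constant a, P_f is the logarithmic derivative of h' g, and P\<phi> is
  that of \<phi>', so these two functions are proportional. The exponent k = 1 / (1 + a) solves (1 -
  k) / k = a.\<close>

lemma power_branch_if_pre_schwarzian_eq:
  assumes sc: "simply_connected S"
    and P: "\<And>z. z \<in> S \<Longrightarrow> pre_schwarzian_logharmonic h g z = pre_schwarzian \<phi> z"
  shows "\<exists>c d k. Re k > 1 / 2 \<and> is_power_branch S (\<lambda>z. c * \<phi> z + d) k h \<and>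
    (\<forall>z\<in>S. dilatation h g z = (1 - k) / k)"
proof -
  note const = dilatation_constant_on[OF P]
  then obtain a where a: "\<And>z. z \<in> S \<Longrightarrow> dilatation h g z = a"
    by (auto simp: constant_on_def)
  have "cmod a < 1"
    using S(3) a dilatation_less_1 by force
  note half = inverse_one_plus_half_plane[OF this]
  obtain C where "\<And>z. z \<in> S \<Longrightarrow> deriv h z * g z = C * deriv \<phi> z"
  proof (rule proportional_if_logderiv_eq[OF S _ hol'(3), of "\<lambda>z. deriv h z * g z"])
    show "(\<lambda>z. deriv h z * g z) holomorphic_on S"
      by (intro holomorphic_intros hol hol')
    show "deriv (\<lambda>z. deriv h z * g z) z / (deriv h z * g z) = deriv (deriv \<phi>) z / deriv \<phi> z"
      if z: "z \<in> S" for z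
    proof -
      have "deriv (\<lambda>z. deriv h z * g z) z = deriv h z * deriv g z + deriv (deriv h) z * g z"
        using z S(1) hol(2) hol'(1) by (intro deriv_mult holomorphic_on_imp_differentiable_at)
      hence "deriv (\<lambda>z. deriv h z * g z) z / (deriv h z * g z)
          = deriv (deriv h) z / deriv h z + deriv g z / g z"
        using nz z by (simp add: field_simps)
      also have "\<dots> = deriv (deriv \<phi>) z / deriv \<phi> z"
        using P[OF z] deriv_dilatation_eq_0_if_constant_on[OF const z]
        by (simp add: pre_schwarzian_logharmonic_eq[OF z] pre_schwarzian_def)
      finally show ?thesis .
    qed
  qed (use nz in auto)
  then obtain c d where "is_power_branch S (\<lambda>z. c * \<phi> z + d) (1 / (1 + a)) h"
    using power_branch_if_deriv_mult_proportional[OF sc a] by blast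
  moreover have "(1 - 1 / (1 + a)) / (1 / (1 + a)) = a"
    using half by (simp add: field_simps)
  ultimately show ?thesis
    using half(2) a by metis
qed

section \<open>The converse: computing the pre-Schwarzian from the power\<close>

lemma pre_schwarzian_eq_if_power_branch:
  assumes k: "Re k > 1 / 2"
    and br: "is_power_branch S (\<lambda>z. c * \<phi> z + d) k h"
    and om: "\<And>z. z \<in> S \<Longrightarrow> dilatation h g z = (1 - k) / k"
    and z: "z \<in> S"
  shows "pre_schwarzian_logharmonic h g z = pre_schwarzian \<phi> z"
proof -
  have k0: "k \<noteq> 0" using k by auto
  note dphi = holomorphic_derivI[OF hol(3) S(1)] and ddphi = holomorphic_derivI[OF hol'(3) S(1)]
  have gh: "deriv g x * h x = (1 - k) / k * g x * deriv h x" if "x \<in> S" for x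
    using om[OF that] nz that by (auto simp: dilatation_def field_simps)
  have "dilatation h g constant_on S"
    using om by (auto simp: constant_on_def)
  hence P: "pre_schwarzian_logharmonic h g z = deriv (deriv h) z / deriv h z + deriv g z / g z"
    using deriv_dilatation_eq_0_if_constant_on[OF _ z] by (simp add: pre_schwarzian_logharmonic_eq[OF z])
  have *: "deriv (deriv h) z / deriv h z + deriv g z / g z = deriv (deriv \<phi>) z / deriv \<phi> z"
  proof (cases "k = 1")
    case True
    \<comment> \<open>For k = 1 the prescribed dilatation is 0, so only h'' / h' remains.\<close>
    have "deriv g z = 0"
      by (rule deriv_eq_0_if_deriv_mult_eq_0[OF S(1) hol(2,1)]) (use nz gh True z in auto)
    have h: "\<And>x. x \<in> S \<Longrightarrow> h x = c * \<phi> x + d"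
      using br True by (simp add: is_power_branch_def)
    have dh: "deriv h x = c * deriv \<phi> x" if "x \<in> S" for x
    proof (rule DERIV_imp_deriv)
      have "((\<lambda>x. c * \<phi> x + d) has_field_derivative c * deriv \<phi> x) (at x)"
        by (rule derivative_eq_intros dphi[OF that] refl)+ simp
      thus "(h has_field_derivative c * deriv \<phi> x) (at x)"
        by (rule has_field_derivative_transform_within_open[OF _ S(1) that]) (use h in auto)
    qed
    have "deriv (deriv h) z = c * deriv (deriv \<phi>) z"
    proof (rule DERIV_imp_deriv)
      have "((\<lambda>x. c * deriv \<phi> x) has_field_derivative c * deriv (deriv \<phi>) z) (at z)"
        by (rule derivative_eq_intros ddphi[OF z] refl)+ simp
      thus "(deriv h has_field_derivative c * deriv (deriv \<phi>) z) (at z)"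
        by (rule has_field_derivative_transform_within_open[OF _ S(1) z]) (use dh in auto)
    qed
    \<comment> \<open>h' = c \<phi>' is nonzero at \<open>z\<close>, hence so is \<open>c\<close>,
      which cancels in the quotient.\<close>
    thus ?thesis using \<open>deriv g z = 0\<close> dh[OF z] nz(1)[OF z] by auto
  next
    case False
    then obtain l where l: "l holomorphic_on S" "\<And>x. x \<in> S \<Longrightarrow> exp (l x) = c * \<phi> x + d"
      "\<And>x. x \<in> S \<Longrightarrow> h x = exp (k * l x)"
      using br by (auto simp: is_power_branch_def)
    note dl = holomorphic_derivI[OF l(1) S(1)]
    \<comment> \<open>Both sides are the derivative of c \<phi> + d, once written as exp l.\<close>
    have dphi_l: "deriv l x * exp (l x) = c * deriv \<phi> x" if "x \<in> S" for x
    proof (rule DERIV_unique)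
      have "((\<lambda>x. exp (l x)) has_field_derivative deriv l x * exp (l x)) (at x)"
        by (rule derivative_eq_intros dl[OF that] refl)+ simp
      thus "((\<lambda>x. c * \<phi> x + d) has_field_derivative deriv l x * exp (l x)) (at x)"
        by (rule has_field_derivative_transform_within_open[OF _ S(1) that]) (use l in auto)
      show "((\<lambda>x. c * \<phi> x + d) has_field_derivative c * deriv \<phi> x) (at x)"
        by (rule derivative_eq_intros dphi[OF that] refl)+ simp
    qed
    have dh_l: "deriv h x = k * deriv l x * exp (k * l x)" if "x \<in> S" for x
    proof (rule DERIV_imp_deriv)
      have "((\<lambda>x. exp (k * l x)) has_field_derivative k * deriv l x * exp (k * l x)) (at x)"
        by (rule derivative_eq_intros dl[OF that] refl)+ simp
      thus "(h has_field_derivative k * deriv l x * exp (k * l x)) (at x)"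
        by (rule has_field_derivative_transform_within_open[OF _ S(1) that]) (use l in auto)
    qed
    \<comment> \<open>The rule h' = k c (c \<phi> + d)^(k - 1) \<phi>', with the power written
      through \<open>l\<close>. Trading l' for \<phi>' keeps l'' out of h''.\<close>
    have dh: "deriv h x = k * c * exp ((k - 1) * l x) * deriv \<phi> x" if "x \<in> S" for x
    proof -
      have "exp (k * l x) = exp (l x) * exp ((k - 1) * l x)"
        by (simp flip: exp_add add: algebra_simps)
      hence "deriv h x = k * exp ((k - 1) * l x) * (deriv l x * exp (l x))"
        by (simp add: dh_l[OF that])
      thus ?thesis by (simp add: dphi_l[OF that])
    qed
    have "deriv (deriv h) z = k * c * exp ((k - 1) * l z)
        * ((k - 1) * deriv l z * deriv \<phi> z + deriv (deriv \<phi>) z)" (is "_ = ?D")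
    proof (rule DERIV_imp_deriv)
      have "((\<lambda>x. k * c * exp ((k - 1) * l x) * deriv \<phi> x) has_field_derivative ?D) (at z)"
        by (rule derivative_eq_intros ddphi[OF z] dl[OF z] refl)+ (simp add: algebra_simps)
      thus "(deriv h has_field_derivative ?D) (at z)"
        by (rule has_field_derivative_transform_within_open[OF _ S(1) z]) (use dh in auto)
    qed
    \<comment> \<open>The common factor k c exp ((k - 1) l) cancels: it is nonzero because h'
      is.\<close>
    hence "deriv (deriv h) z / deriv h z
        = ((k - 1) * deriv l z * deriv \<phi> z + deriv (deriv \<phi>) z) / deriv \<phi> z"
      using nz(1)[OF z] dh[OF z] by simp
    hence "deriv (deriv h) z / deriv h z = (k - 1) * deriv l z + deriv (deriv \<phi>) z / deriv \<phi> z"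
      using nz(3)[OF z] by (simp add: add_divide_distrib)
    \<comment> \<open>Here g' / g = ((1 - k) / k) h' / h with h' / h = k l'. The result cancels the
      term (k - 1) l' in h'' / h'.\<close>
    moreover have "deriv g z / g z = (1 - k) * deriv l z"
    proof -
      have "deriv g z * exp (k * l z) = ((1 - k) * deriv l z * g z) * exp (k * l z)"
        using gh[OF z] k0 by (simp add: l(3)[OF z] dh_l[OF z] mult_ac)
      hence "deriv g z = (1 - k) * deriv l z * g z"
        by simp
      thus ?thesis using nz(2)[OF z] by simp
    qed
    ultimately show ?thesis by algebra
  qed
  show ?thesis
    by (simp only: P * pre_schwarzian_def)
qed

end

theorem proposition2:
  fixes \<Omega> :: "complex set" and f h g \<phi> :: "complex \<Rightarrow> complex"
  assumes "open \<Omega>" and "connected \<Omega>" and "\<Omega> \<noteq> {}" and "simply_connected \<Omega>"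
    and "sp_loc_univalent_logharmonic \<Omega> f h g"
    and "loc_univalent_holomorphic \<Omega> \<phi>"
  shows "(\<forall>z\<in>\<Omega>. pre_schwarzian_logharmonic h g z = pre_schwarzian \<phi> z) \<longleftrightarrow>
    (\<exists>c d k :: complex. Re k > 1 / 2 \<and>
       is_power_branch \<Omega> (\<lambda>z. c * \<phi> z + d) k h \<and>
       (\<forall>z\<in>\<Omega>. dilatation h g z = (1 - k) / k))"
proof -
  interpret logharmonic_setup \<Omega> f h g \<phi>
    using assms by unfold_locales
  show ?thesis
    using power_branch_if_pre_schwarzian_eq[OF assms(4)] pre_schwarzian_eq_if_power_branch
    by blast
qed

end
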